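(* Let $q\in[0,2]$ and $n\ge3$. Consider the additive collaboration model $X_{ij}=\theta_{r(i)}+\theta_{r(j)}+Z_{ij}$, $1\le i\neq j\le n$, with known $\theta_1,\dots,\theta_n\in\mathbb R$. Assume that the noise satisfies, with parameter $\sigma>0$: for every $t>0$ and all reals $(v_{ij})_{1\le i\neq j\le n}$ with $\sum_{i\ne j}v_{ij}^2=1$, $\mathbb P(\sum_{1\le i\ne j\le n}v_{ij}Z_{ij}>t)\le\exp(-t^2/(2\sigma^2))$. Assume also that, with parameter $\beta\in\mathbb R$, for all $r,\tilde r\in\mathcal R$, $\sum_{i=1}^n(\theta_{r(i)}-\theta_{\tilde r(i)})^2\ge\beta^2\|\tilde r-r\|^2$. Define the scores $$S_i=\frac1{2(n-2)}\left(\sum_{j\in[n]\setminus\{i\}}(X_{ij}+X_{ji})-\frac1{n-1}\sum_{1\le k\ne l\le n}X_{kl}\right),\qquad i\in[n],$$ and let $$\hat r\in\mathop{\mathrm{argmin}}_{r\in\mathcal R}\sum_{i=1}^n(S_i-\theta_{r(i)})^2 .$$ Then there exist a constant $C>0$ independent of $n$ and a sequence $\eta_n\to0$ such that, for all $n\ge3$, $$\sup_{r\in\mathcal R}\mathbb E_r\,\ell_q(\hat r,r)\le C\begin{cases}\exp\left(-(1+\eta_n)s_n\right), & s_n>1,\\[2pt] s_n^{-q/2}\wedge n^q, & s_n\le 1,\end{cases}\qquad\text{where } s_n=\frac{n\beta^2}{4\sigma^2}$$ (if $\beta=0$, the bound in the second case is read as $n^q$). Moreover, when $\liminf_{n}\frac{n\beta^2}{4\sigma^2\log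 n}>1$, we have $\hat r=r$ with probability $1-o(1)$, i.e. $\inf_{r\in\mathcal R}\mathbb P_r(\hat r=r)\to1$ as $n\to\infty$.
   Context: Write $[n]=\{1,\dots,n\}$, $a\wedge b=\min(a,b)$, and let $\|\cdot\|$ be the Euclidean norm on $\mathbb R^n$. All model quantities may depend on $n$, and asymptotics are as $n\to\infty$. Rank space: $\mathcal R=\{r=(r(1),\dots,r(n))\in[n]^n:\ |\sum_{i=1}^n r(i)-\sum_{i=1}^n i|\le c_n\}$, where $c_n$ satisfies $1\le c_n=o(\sqrt n)$. For $r\in\mathcal R$, $\mathbb P_r$ (with expectation $\mathbb E_r$) is the law of the observations $\{X_{ij}\}_{1\le i\ne j\le n}$ when the true rank vector is $r$. Loss: $\ell_0(\hat r,r)=\frac1n\sum_{i=1}^n\mathbb I\{\hat r(i)\ne r(i)\}$, and $\ell_q(\hat r,r)=\frac1n\sum_{i=1}^n|\hat r(i)-r(i)|^q$ for $q\in(0,2]$. *)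

theory Defs
  imports "HOL-Probability.Probability" "HOL-Library.Landau_Symbols"
begin

definition off_diag :: "nat \<Rightarrow> (nat \<times> nat) set" where
  "off_diag n = {(i, j). i \<in> {1..n} \<and> j \<in> {1..n} \<and> i \<noteq> j}"

text \<open>
  Rank vectors are extensional functions on \<open>{1..n}\<close>, so equality of functions is
  equality of vectors.  They need not be permutations.
\<close>

definition rank_space :: "nat \<Rightarrow> real \<Rightarrow> (nat \<Rightarrow> nat) set" where
  "rank_space n c =
     {r \<in> {1..n} \<rightarrow>\<^sub>E {1..n}. \<bar>(\<Sum>i = 1..n. real (r i)) - (\<Sum>i = 1..n. real i)\<bar> \<le> c}"

definition rank_loss :: "real \<Rightarrow> nat \<Rightarrow> (nat \<Rightarrow> nat) \<Rightarrow> (nat \<Rightarrow> nat) \<Rightarrow> real" where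
  "rank_loss q n r' r =
     (if q = 0 then (1 / real n) * (\<Sum>i = 1..n. of_bool (r' i \<noteq> r i))
      else (1 / real n) * (\<Sum>i = 1..n. \<bar>real (r' i) - real (r i)\<bar> powr q))"

definition obs_space :: "nat \<Rightarrow> (nat \<times> nat \<Rightarrow> real) measure" where
  "obs_space n = Pi\<^sub>M (off_diag n) (\<lambda>_. borel)"

text \<open>
  The law of \<open>X\<^sub>i\<^sub>j = \<theta>(r(i)) + \<theta>(r(j)) + Z\<^sub>i\<^sub>j\<close>, \<open>i \<noteq> j\<close>, where the noise \<open>Z\<close> lives on
  the probability space \<open>M\<close> and does not depend on \<open>r\<close>.
\<close>

definition additive_law ::
  "nat \<Rightarrow> (nat \<Rightarrow> real) \<Rightarrow> 'w measure \<Rightarrow> (nat \<Rightarrow> nat \<Rightarrow> 'w \<Rightarrow> real) \<Rightarrow> (nat \<Rightarrow> nat)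
     \<Rightarrow> (nat \<times> nat \<Rightarrow> real) measure" where
  "additive_law n \<theta> M Z r =
     distr M (obs_space n) (\<lambda>\<omega>. \<lambda>(i, j)\<in>off_diag n. \<theta> (r i) + \<theta> (r j) + Z i j \<omega>)"

definition subgaussian_noise ::
  "nat \<Rightarrow> 'w measure \<Rightarrow> (nat \<Rightarrow> nat \<Rightarrow> 'w \<Rightarrow> real) \<Rightarrow> real \<Rightarrow> bool" where
  "subgaussian_noise n M Z \<sigma> \<longleftrightarrow>
     (\<forall>t > 0. \<forall>v :: nat \<Rightarrow> nat \<Rightarrow> real. (\<Sum>(i, j)\<in>off_diag n. (v i j)\<^sup>2) = 1 \<longrightarrow>
        measure M {\<omega> \<in> space M. (\<Sum>(i, j)\<in>off_diag n. v i j * Z i j \<omega>) > t}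
          \<le> exp (- t\<^sup>2 / (2 * \<sigma>\<^sup>2)))"

definition score :: "nat \<Rightarrow> (nat \<times> nat \<Rightarrow> real) \<Rightarrow> nat \<Rightarrow> real" where
  "score n x i =
     1 / (2 * (real n - 2)) *
       ((\<Sum>j\<in>{1..n} - {i}. x (i, j) + x (j, i))
          - 1 / (real n - 1) * (\<Sum>(k, l)\<in>off_diag n. x (k, l)))"

definition snr :: "nat \<Rightarrow> real \<Rightarrow> real \<Rightarrow> real" where
  "snr n \<beta> \<sigma> = real n * \<beta>\<^sup>2 / (4 * \<sigma>\<^sup>2)"

text \<open>
  Here \<open>s\<close> is the signal-to-noise ratio.  The case \<open>s = 0\<close> is separate because
  \<open>0 powr a = 0\<close>, whereas for \<open>\<beta> = 0\<close> the rate is to be read as \<open>n powr q\<close>.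
\<close>

definition risk_rate :: "real \<Rightarrow> nat \<Rightarrow> real \<Rightarrow> real \<Rightarrow> real" where
  "risk_rate q n \<eta> s =
     (if s > 1 then exp (- (1 + \<eta>) * s)
      else if s = 0 then real n powr q
      else min (s powr (- q / 2)) (real n powr q))"

end

theory Submission
  imports Defs "HOL-Real_Asymp.Real_Asymp"
begin

text \<open>
  Write \<open>W\<^sub>i\<close> for the score computed from the noise alone, \<open>\<Delta>\<^sub>i = \<theta>(r'(i)) - \<theta>(r(i))\<close> for a
  competitor \<open>r'\<close>, \<open>d\<^sup>2(r') = \<Sum>\<^sub>i (r'(i) - r(i))\<^sup>2\<close> and \<open>s\<close> for the signal-to-noise ratio.  The
  scores are unbiased, \<open>S\<^sub>i = \<theta>(r(i)) + W\<^sub>i\<close>, and the linear form \<open>\<Sum>\<^sub>i \<Delta>\<^sub>i W\<^sub>i\<close> is a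
  linear form in the noise whose squared coefficients sum to at most
  \<open>\<Sum>\<^sub>i \<Delta>\<^sub>i\<^sup>2 / (2 (n - 2))\<close> (lemma \<open>sum_score_weight_le\<close>).  Optimality of the estimator at
  \<open>r'\<close> forces \<open>\<Sum>\<^sub>i \<Delta>\<^sub>i\<^sup>2 \<le> 2 \<Sum>\<^sub>i \<Delta>\<^sub>i W\<^sub>i\<close> (lemma \<open>basic_inequality\<close>).  Everything
  follows from bounds on the expected squared distance of the estimator from \<open>r\<close>.

  Small ratio, \<open>s \<le> 1\<close>: the basic inequality gives \<open>\<beta>\<^sup>2 d\<^sup>2 \<le> 4 \<Sum>\<^sub>i W\<^sub>i\<^sup>2\<close>, and
  \<open>E W\<^sub>i\<^sup>2\<close> is of order \<open>\<sigma>\<^sup>2 / n\<close>, so \<open>s E d\<^sup>2 / n\<close> is bounded by a constant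
  (lemma \<open>snr_mult_expected_sqdist_le\<close>).  This is enough because
  \<open>\<bar>x\<bar> powr q \<le> s powr (- q / 2) * (1 + s x\<^sup>2)\<close> for \<open>0 \<le> q \<le> 2\<close>.  The
  alternative rate \<open>n powr q\<close> is trivial, as two ranks differ by less than \<open>n\<close>.

  Large ratio, \<open>s > 1\<close>: put \<open>s' = (1 - 2/n) s\<close>.  The tail bound gives
  \<open>P(estimator = r') \<le> exp (- s' d\<^sup>2(r'))\<close> (lemma \<open>prob_est_le\<close>).  Summing the exponential
  moment over all of \<open>{1..n}\<^sup>n\<close>, where it factorises over coordinates, yields for every
  \<open>\<mu> < s'\<close>
  \[ E \exp (\mu d^2) \le \Bigl(\sum_k e^{-(s' - \mu) k^2}\Bigr)^n
       \le \exp \Bigl(2 n \, \frac{e^{-(s' - \mu)}}{1 - e^{-(s' - \mu)}}\Bigr) , \]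
  and \<open>1 + x \<le> exp x\<close> turns this into a bound on \<open>E d\<^sup>2\<close>.  Since \<open>s' > 1/3\<close>, the choice
  \<open>\<mu> = 1/6\<close> gives \<open>E d\<^sup>2 \<le> const * n * exp (- s')\<close> (lemma \<open>expected_sqdist_high_snr\<close>).  The
  ranks being integers, every loss is at most \<open>d\<^sup>2 / n\<close>; the theorem thus holds with
  \<open>\<eta>\<^sub>n = - 2/n\<close>.  Exact recovery follows as well, because the estimator differs from \<open>r\<close>
  with probability at most \<open>E d\<^sup>2\<close>.
\<close>

section \<open>Algebra of the scores\<close>

lemma finite_off_diag [simp]: "finite (off_diag n)"
  by (rule finite_subset[of _ "{1..n} \<times> {1..n}"]) (auto simp: off_diag_def)

lemma sum_off_diag:
  fixes f :: "nat \<Rightarrow> nat \<Rightarrow> real"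
  shows "(\<Sum>(i, j)\<in>off_diag n. f i j) = (\<Sum>i=1..n. \<Sum>j=1..n. f i j) - (\<Sum>i=1..n. f i i)"
proof -
  have "{1..n} \<times> {1..n} = off_diag n \<union> (\<lambda>i. (i, i)) ` {1..n}"
    by (auto simp: off_diag_def)
  moreover have "off_diag n \<inter> (\<lambda>i. (i, i)) ` {1..n} = {}"
    by (auto simp: off_diag_def)
  ultimately have "(\<Sum>(i, j)\<in>{1..n} \<times> {1..n}. f i j) =
      (\<Sum>(i, j)\<in>off_diag n. f i j) + (\<Sum>(i, j)\<in>(\<lambda>i. (i, i)) ` {1..n}. f i j)"
    by (simp add: sum.union_disjoint)
  also have "(\<Sum>(i, j)\<in>(\<lambda>i. (i, i)) ` {1..n}. f i j) = (\<Sum>i=1..n. f i i)"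
    by (subst sum.reindex) (auto simp: inj_on_def)
  finally show ?thesis
    by (simp add: sum.cartesian_product)
qed

lemma score_cong:
  assumes "i \<in> {1..n}" "\<And>p. p \<in> off_diag n \<Longrightarrow> x p = y p"
  shows "score n x i = score n y i"
proof -
  have "(\<Sum>j\<in>{1..n} - {i}. x (i, j) + x (j, i)) = (\<Sum>j\<in>{1..n} - {i}. y (i, j) + y (j, i))"
    using assms by (intro sum.cong) (auto simp: off_diag_def)
  moreover have "(\<Sum>(k, l)\<in>off_diag n. x (k, l)) = (\<Sum>(k, l)\<in>off_diag n. y (k, l))"
    using assms by (intro sum.cong) auto
  ultimately show ?thesis
    by (simp add: score_def)
qed

lemma score_add: "score n (\<lambda>p. x p + y p) i = score n x i + score n y i"
  by (simp add: score_def sum.distrib split_beta algebra_simps add_divide_distrib diff_divide_distrib)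

text \<open>The scores are unbiased: on the noiseless observations they return the parameters.\<close>

lemma score_additive:
  assumes n: "n \<ge> 3" and i: "i \<in> {1..n}"
  shows "score n (\<lambda>(k, l). u k + u l) i = u i"
proof -
  define T where "T = (\<Sum>k=1..n. u k)"
  have pairs: "(\<Sum>(k, l)\<in>off_diag n. u k + u l) = 2 * (real n - 1) * T"
    using n by (simp add: sum_off_diag sum.distrib T_def sum_distrib_left algebra_simps)
  have row: "(\<Sum>j\<in>{1..n} - {i}. u i + u j + (u j + u i)) = 2 * (real n - 2) * u i + 2 * T"
    using n i by (simp add: sum_diff1 sum.distrib T_def sum_distrib_left algebra_simps)
  show ?thesis
    using n unfolding score_def case_prod_conv pairs row by (simp add: divide_simps) (simp add: algebra_simps)
qed

text \<open>
  The coefficient of the observation \<open>(k, l)\<close> in the linear form \<open>\<Sum>\<^sub>i \<Delta>\<^sub>i S\<^sub>i\<close>.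
\<close>

definition score_weight :: "nat \<Rightarrow> (nat \<Rightarrow> real) \<Rightarrow> nat \<Rightarrow> nat \<Rightarrow> real" where
  "score_weight n \<Delta> k l =
     (\<Delta> k + \<Delta> l - (\<Sum>i=1..n. \<Delta> i) / (real n - 1)) / (2 * (real n - 2))"

lemma sum_mult_score:
  "(\<Sum>i=1..n. \<Delta> i * score n (\<lambda>(k, l). z k l) i) =
     (\<Sum>(k, l)\<in>off_diag n. score_weight n \<Delta> k l * z k l)"
proof -
  define D where "D = (\<Sum>i=1..n. \<Delta> i)"
  define T where "T = (\<Sum>(k, l)\<in>off_diag n. z k l)"
  define g where "g = 1 / (real n - 1)"
  define h where "h = 1 / (2 * (real n - 2))"
  have sw: "score_weight n \<Delta> k l = h * (\<Delta> k + \<Delta> l - g * D)" for k l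
    by (simp add: score_weight_def h_def g_def D_def)
  have "(\<Sum>i=1..n. \<Delta> i * score n (\<lambda>(k, l). z k l) i) =
      (\<Sum>i=1..n. \<Delta> i * (h * ((\<Sum>j=1..n. z i j + z j i) - 2 * z i i - g * T)))"
    by (intro sum.cong) (auto simp: score_def h_def g_def T_def sum_diff1)
  also have "\<dots> = h * ((\<Sum>i=1..n. \<Sum>j=1..n. \<Delta> i * z i j + \<Delta> i * z j i)
                        - 2 * (\<Sum>i=1..n. \<Delta> i * z i i) - g * D * T)"
    by (simp add: D_def algebra_simps sum.distrib sum_subtractf sum_distrib_left sum_distrib_right)
  also have "(\<Sum>i=1..n. \<Sum>j=1..n. \<Delta> i * z i j + \<Delta> i * z j i) =
      (\<Sum>k=1..n. \<Sum>l=1..n. (\<Delta> k + \<Delta> l) * z k l)"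
    using sum.swap[of "\<lambda>i j. \<Delta> i * z j i" "{1..n}" "{1..n}"]
    by (simp add: sum.distrib distrib_right)
  also have "h * ((\<Sum>k=1..n. \<Sum>l=1..n. (\<Delta> k + \<Delta> l) * z k l)
                        - 2 * (\<Sum>i=1..n. \<Delta> i * z i i) - g * D * T) =
      h * ((\<Sum>(k, l)\<in>off_diag n. (\<Delta> k + \<Delta> l) * z k l) - g * D * T)"
    by (simp add: sum_off_diag sum_distrib_left sum.distrib algebra_simps)
  also have "\<dots> = (\<Sum>(k, l)\<in>off_diag n. score_weight n \<Delta> k l * z k l)"
    by (simp add: sw T_def sum_distrib_left sum_subtractf[symmetric] algebra_simps split_beta)
  finally show ?thesis .
qed

text \<open>
  The left-hand side equals \<open>(2 Q - D\<^sup>2 / (n - 1)) / (4 (n - 2))\<close>, with \<open>Q\<close> the sum of squares and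
  \<open>D\<close> the sum of the \<open>\<Delta>\<^sub>i\<close>.
\<close>

lemma sum_score_weight_le:
  assumes n: "n \<ge> 3"
  shows "(\<Sum>(k, l)\<in>off_diag n. (score_weight n \<Delta> k l)\<^sup>2) \<le> (\<Sum>i=1..n. (\<Delta> i)\<^sup>2) / (2 * (real n - 2))"
proof -
  define D where "D = (\<Sum>i=1..n. \<Delta> i)"
  define Q where "Q = (\<Sum>i=1..n. (\<Delta> i)\<^sup>2)"
  define g where "g = D / (real n - 1)"
  have gD: "g * (real n - 1) = D" using n by (simp add: g_def)
  have a: "(\<Sum>k=1..n. \<Sum>l=1..n. (\<Delta> k + \<Delta> l - g)\<^sup>2) = 2 * n * Q + 2 * (D * D) + n * n * g\<^sup>2 - 4 * n * g * D"
  proof -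
    have "(\<Sum>l=1..n. (\<Delta> k + \<Delta> l - g)\<^sup>2) =
        n * (\<Delta> k)\<^sup>2 + Q + n * g\<^sup>2 + 2 * D * \<Delta> k - 2 * n * g * \<Delta> k - 2 * g * D" for k
      by (simp add: power2_eq_square algebra_simps sum.distrib sum_subtractf Q_def D_def
          sum_distrib_left sum_distrib_right)
    moreover have "sum \<Delta> {Suc 0..n} = D" "(\<Sum>k=Suc 0..n. (\<Delta> k)\<^sup>2) = Q"
      by (simp_all add: D_def Q_def)
    ultimately show ?thesis
      by (simp add: sum.distrib sum_subtractf flip: sum_distrib_left sum_distrib_right)
  qed
  have b: "(\<Sum>k=1..n. (\<Delta> k + \<Delta> k - g)\<^sup>2) = 4 * Q - 4 * g * D + n * g\<^sup>2"
    by (simp add: power2_eq_square algebra_simps sum.distrib sum_subtractf Q_def D_def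
       sum_distrib_left sum_distrib_right)
  have "(\<Sum>(k, l)\<in>off_diag n. (score_weight n \<Delta> k l)\<^sup>2) =
      (\<Sum>(k, l)\<in>off_diag n. (\<Delta> k + \<Delta> l - g)\<^sup>2) / (2 * (real n - 2))\<^sup>2"
    by (simp add: score_weight_def g_def D_def power_divide sum_divide_distrib split_beta)
  also have "(\<Sum>(k, l)\<in>off_diag n. (\<Delta> k + \<Delta> l - g)\<^sup>2) =
      2 * (real n - 2) * Q - (real n - 1) * (real n - 2) * g\<^sup>2"
    unfolding sum_off_diag a b gD[symmetric] by (simp add: power2_eq_square algebra_simps)
  also have "\<dots> \<le> 2 * (real n - 2) * Q"
    using n by simp
  finally show ?thesis
    using n by (simp add: divide_right_mono Q_def power2_eq_square)
qed

section \<open>Discrete Gaussian sums and second moments\<close>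

lemma sum_power_le_geometric:
  fixes \<rho> :: real
  assumes "0 \<le> \<rho>" "\<rho> < 1"
  shows "(\<Sum>k<m. \<rho> ^ k) \<le> 1 / (1 - \<rho>)"
proof -
  have "(\<Sum>k<m. \<rho> ^ k) = (1 - \<rho> ^ m) / (1 - \<rho>)"
    using assms by (simp add: sum_gp_strict)
  also have "\<dots> \<le> 1 / (1 - \<rho>)"
    using assms by (intro divide_right_mono) auto
  finally show ?thesis .
qed

lemma sum_exp_neg_square_le:
  assumes \<kappa>: "\<kappa> > 0"
  shows "(\<Sum>a=1..n. exp (- \<kappa> * (real a - real b)\<^sup>2)) \<le> 1 + 2 * (exp (- \<kappa>) / (1 - exp (- \<kappa>)))"
proof -
  define \<rho> where "\<rho> = exp (- \<kappa>)"
  have \<rho>: "0 \<le> \<rho>" "\<rho> < 1" using \<kappa> by (auto simp: \<rho>_def)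
  define f where "f a = exp (- \<kappa> * (real a - real b)\<^sup>2)" for a
  have f_le: "f a \<le> \<rho> ^ k" if "\<bar>real a - real b\<bar> = real k" for a k
  proof -
    have "real k \<le> (real k)\<^sup>2"
      by (simp add: power2_eq_square flip: of_nat_mult)
    then have "f a \<le> exp (real k * - \<kappa>)"
      using \<kappa> that unfolding f_def by (subst power2_abs[symmetric]) (simp add: mult.commute)
    then show ?thesis by (simp only: \<rho>_def exp_of_nat_mult)
  qed
  have below: "(\<Sum>a<b. f a) \<le> \<rho> / (1 - \<rho>)"
  proof -
    have "(\<Sum>a<b. f a) \<le> (\<Sum>a<b. \<rho> * \<rho> ^ (b - Suc a))"
    proof (rule sum_mono)
      fix a assume "a \<in> {..<b}"
      then have "f a \<le> \<rho> ^ Suc (b - Suc a)"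
        by (intro f_le) auto
      then show "f a \<le> \<rho> * \<rho> ^ (b - Suc a)" by simp
    qed
    also have "\<dots> = \<rho> * (\<Sum>k<b. \<rho> ^ k)"
      by (simp add: sum.nat_diff_reindex[of "\<lambda>k. \<rho> ^ k"] flip: sum_distrib_left)
    also have "\<dots> \<le> \<rho> * (1 / (1 - \<rho>))"
      using \<rho> by (intro mult_left_mono sum_power_le_geometric) auto
    finally show ?thesis by simp
  qed
  have above: "(\<Sum>k<n. f (Suc b + k)) \<le> \<rho> / (1 - \<rho>)"
  proof -
    have "(\<Sum>k<n. f (Suc b + k)) \<le> (\<Sum>k<n. \<rho> * \<rho> ^ k)"
      using f_le[of _ "Suc _"] by (intro sum_mono) auto
    also have "\<dots> = \<rho> * (\<Sum>k<n. \<rho> ^ k)"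
      by (simp add: sum_distrib_left)
    also have "\<dots> \<le> \<rho> * (1 / (1 - \<rho>))"
      using \<rho> by (intro mult_left_mono sum_power_le_geometric) auto
    finally show ?thesis by simp
  qed
  have "(\<Sum>a=1..n. f a) \<le> sum f ({..<b} \<union> ({b} \<union> (\<lambda>k. Suc b + k) ` {..<n}))"
  proof (rule sum_mono2)
    show "{1..n} \<subseteq> {..<b} \<union> ({b} \<union> (\<lambda>k. Suc b + k) ` {..<n})"
    proof
      fix a assume "a \<in> {1..n}"
      then show "a \<in> {..<b} \<union> ({b} \<union> (\<lambda>k. Suc b + k) ` {..<n})"
        by (cases "a \<le> b") (auto intro!: image_eqI[of _ _ "a - Suc b"])
    qed
  qed (auto simp: f_def)
  also have "\<dots> = (\<Sum>a<b. f a) + (f b + (\<Sum>k<n. f (Suc b + k)))"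
    by (subst sum.union_disjoint; (auto; fail)?)+ (auto simp: sum.reindex inj_on_def)
  also have "f b = 1" by (simp add: f_def)
  finally show ?thesis
    using below above unfolding f_def[symmetric] \<rho>_def[symmetric] by linarith
qed

text \<open>
  The constant in lemma \<open>second_moment_le\<close> below; its value is irrelevant.
\<close>

definition gauss_moment :: real where
  "gauss_moment = (\<Sum>k. (2 * real k + 1) * (2 * exp (- (real k)\<^sup>2 / 2)))"

lemma summable_gauss_moment: "summable (\<lambda>k. (2 * real k + 1) * (2 * exp (- (real k)\<^sup>2 / 2)))"
proof (rule summable_comparison_test)
  show "\<exists>N. \<forall>k\<ge>N. norm ((2 * real k + 1) * (2 * exp (- (real k)\<^sup>2 / 2))) \<le>
      4 * (of_nat (Suc k) * exp (- 1 / 2) ^ k)"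
  proof (intro exI allI impI)
    fix k :: nat
    have "real k \<le> (real k)\<^sup>2"
      by (simp add: power2_eq_square flip: of_nat_mult)
    then have "exp (- (real k)\<^sup>2 / 2) \<le> exp (real k * (- 1 / 2))" by simp
    also have "\<dots> = exp (- 1 / 2) ^ k" by (rule exp_of_nat_mult)
    finally have "(2 * real k + 1) * (2 * exp (- (real k)\<^sup>2 / 2)) \<le>
        (2 * real (Suc k)) * (2 * exp (- 1 / 2) ^ k)"
      by (intro mult_mono) auto
    then show "norm ((2 * real k + 1) * (2 * exp (- (real k)\<^sup>2 / 2))) \<le>
        4 * (of_nat (Suc k) * exp (- 1 / 2) ^ k)"
      by (simp add: abs_mult algebra_simps)
  qed
  show "summable (\<lambda>k. 4 * (of_nat (Suc k) * exp (- 1 / 2 :: real) ^ k))"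
    by (intro summable_mult sums_summable[OF geometric_deriv_sums]) simp
qed

lemma gauss_moment_pos: "gauss_moment > 0"
  unfolding gauss_moment_def by (intro suminf_pos summable_gauss_moment) (simp add: add_nonneg_pos)

text \<open>
  A discrete layer-cake bound: \<open>1 + 3 + ... + (2 m - 1) = m\<^sup>2\<close>.
\<close>

lemma square_le_layers:
  fixes y :: real assumes "\<bar>y\<bar> < real m"
  shows "y\<^sup>2 \<le> (\<Sum>k<m. (2 * real k + 1) * of_bool (real k \<le> \<bar>y\<bar>))"
  using assms
proof (induction m)
  case 0
  then show ?case by simp
next
  case (Suc m)
  show ?case
  proof (cases "\<bar>y\<bar> < real m")
    case True
    then show ?thesis using Suc.IH by simp
  next
    case False
    have "(\<Sum>k<Suc m. (2 * real k + 1) * of_bool (real k \<le> \<bar>y\<bar>)) = (\<Sum>k<Suc m. 2 * real k + 1)"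
      using False by (intro sum.cong) auto
    also have "\<dots> = (real (Suc m))\<^sup>2"
      by (induction m) (auto simp: power2_eq_square algebra_simps)
    finally show ?thesis
      using Suc.prems by (simp add: abs_le_square_iff[symmetric] del: sum.lessThan_Suc)
  qed
qed

text \<open>
  A variable with Gaussian tails of scale \<open>a\<close> is square integrable, with second moment of
  order \<open>a\<^sup>2\<close>.
\<close>

lemma (in prob_space) second_moment_le:
  fixes Y :: "'a \<Rightarrow> real"
  assumes Y[measurable]: "Y \<in> borel_measurable M" and a: "a > 0"
    and tail: "\<And>t. t > 0 \<Longrightarrow> prob {\<omega> \<in> space M. t \<le> \<bar>Y \<omega>\<bar>} \<le> 2 * exp (- t\<^sup>2 / (2 * a\<^sup>2))"
  shows "integrable M (\<lambda>\<omega>. (Y \<omega>)\<^sup>2)" "expectation (\<lambda>\<omega>. (Y \<omega>)\<^sup>2) \<le> a\<^sup>2 * gauss_moment"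
proof -
  define A where "A k = {\<omega> \<in> space M. real k * a \<le> \<bar>Y \<omega>\<bar>}" for k :: nat
  have A[measurable]: "A k \<in> sets M" for k by (simp add: A_def)
  have pA: "prob (A k) \<le> 2 * exp (- (real k)\<^sup>2 / 2)" for k
  proof (cases "k = 0")
    case True
    then show ?thesis using order.trans[OF prob_le_1[of "A k"], of 2] by simp
  next
    case False
    then have "prob (A k) \<le> 2 * exp (- (real k * a)\<^sup>2 / (2 * a\<^sup>2))"
      unfolding A_def using a by (intro tail) auto
    then show ?thesis using a by (simp add: power_mult_distrib)
  qed
  have "(\<integral>\<^sup>+\<omega>. ennreal ((Y \<omega>)\<^sup>2) \<partial>M) \<le>
      (\<integral>\<^sup>+\<omega>. (\<Sum>k. ennreal (a\<^sup>2 * (2 * real k + 1)) * indicator (A k) \<omega>) \<partial>M)"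
  proof (rule nn_integral_mono)
    fix \<omega> assume \<omega>: "\<omega> \<in> space M"
    obtain m where m: "\<bar>Y \<omega> / a\<bar> < real m" using reals_Archimedean2 by blast
    have ind: "indicator (A k) \<omega> = ennreal (of_bool (real k \<le> \<bar>Y \<omega> / a\<bar>))" for k
      using a \<omega> by (auto simp: A_def indicator_def field_simps)
    have "(Y \<omega>)\<^sup>2 = a\<^sup>2 * (Y \<omega> / a)\<^sup>2" using a by (simp add: power_divide)
    also have "\<dots> \<le> a\<^sup>2 * (\<Sum>k<m. (2 * real k + 1) * of_bool (real k \<le> \<bar>Y \<omega> / a\<bar>))"
      using square_le_layers[OF m] by (intro mult_left_mono) auto
    also have "\<dots> = (\<Sum>k<m. a\<^sup>2 * (2 * real k + 1) * of_bool (real k \<le> \<bar>Y \<omega> / a\<bar>))"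
      by (simp only: sum_distrib_left mult.assoc)
    finally have "ennreal ((Y \<omega>)\<^sup>2) \<le> ennreal (\<Sum>k<m. a\<^sup>2 * (2 * real k + 1) * of_bool (real k \<le> \<bar>Y \<omega> / a\<bar>))"
      by (rule ennreal_leI)
    also have "\<dots> = (\<Sum>k<m. ennreal (a\<^sup>2 * (2 * real k + 1)) * indicator (A k) \<omega>)"
      unfolding ind by (subst ennreal_mult[symmetric] sum_ennreal; simp)+
    also have "\<dots> \<le> (\<Sum>k. ennreal (a\<^sup>2 * (2 * real k + 1)) * indicator (A k) \<omega>)"
      by (rule sum_le_suminf) auto
    finally show "ennreal ((Y \<omega>)\<^sup>2) \<le> \<dots>" .
  qed
  also have "\<dots> = (\<Sum>k. ennreal (a\<^sup>2 * (2 * real k + 1)) * emeasure M (A k))"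
    by (simp add: nn_integral_suminf nn_integral_cmult_indicator)
  also have "\<dots> \<le> (\<Sum>k. ennreal (a\<^sup>2 * ((2 * real k + 1) * (2 * exp (- (real k)\<^sup>2 / 2)))))"
  proof (rule suminf_le)
    fix k
    have "ennreal (a\<^sup>2 * (2 * real k + 1)) * emeasure M (A k) = ennreal (a\<^sup>2 * (2 * real k + 1) * prob (A k))"
      by (simp add: emeasure_eq_measure ennreal_mult)
    also have "\<dots> \<le> ennreal (a\<^sup>2 * ((2 * real k + 1) * (2 * exp (- (real k)\<^sup>2 / 2))))"
      using pA[of k] by (intro ennreal_leI) (simp add: mult.assoc mult_left_mono)
    finally show "ennreal (a\<^sup>2 * (2 * real k + 1)) * emeasure M (A k) \<le> \<dots>" .
  qed auto
  also have "\<dots> = ennreal (a\<^sup>2 * gauss_moment)"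
    unfolding gauss_moment_def
    by (subst suminf_mult[symmetric, OF summable_gauss_moment])
       (intro suminf_ennreal2 summable_mult summable_gauss_moment; simp)
  finally have le: "(\<integral>\<^sup>+\<omega>. ennreal ((Y \<omega>)\<^sup>2) \<partial>M) \<le> ennreal (a\<^sup>2 * gauss_moment)" .
  then show int: "integrable M (\<lambda>\<omega>. (Y \<omega>)\<^sup>2)"
    by (intro integrableI_nonneg) (auto simp: less_top[symmetric] top_unique)
  then have "ennreal (expectation (\<lambda>\<omega>. (Y \<omega>)\<^sup>2)) \<le> ennreal (a\<^sup>2 * gauss_moment)"
    using le by (simp add: nn_integral_eq_integral)
  then show "expectation (\<lambda>\<omega>. (Y \<omega>)\<^sup>2) \<le> a\<^sup>2 * gauss_moment"
    using gauss_moment_pos by (simp add: ennreal_le_iff)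
qed

section \<open>The additive model for a fixed size and true rank vector\<close>

text \<open>
  The model of size \<open>n\<close> with true rank vector \<open>r\<close>, and the estimator \<open>rhat\<close> as a function of
  the observations.  Separation is needed from the true vector only.
\<close>

locale additive_ranking = prob_space M
  for M :: "'w measure" +
  fixes n :: nat and \<theta> :: "nat \<Rightarrow> real" and Z :: "nat \<Rightarrow> nat \<Rightarrow> 'w \<Rightarrow> real"
    and \<sigma> \<beta> c :: real and r :: "nat \<Rightarrow> nat" and rhat :: "(nat \<times> nat \<Rightarrow> real) \<Rightarrow> nat \<Rightarrow> nat"
  assumes n: "n \<ge> 3"
    and Z_meas: "\<And>i j. (i, j) \<in> off_diag n \<Longrightarrow> Z i j \<in> borel_measurable M"
    and sigma_pos: "\<sigma> > 0"
    and noise: "subgaussian_noise n M Z \<sigma>"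
    and r_in: "r \<in> rank_space n c"
    and separation: "\<And>r'. r' \<in> rank_space n c \<Longrightarrow>
        \<beta>\<^sup>2 * (\<Sum>i=1..n. (real (r' i) - real (r i))\<^sup>2) \<le> (\<Sum>i=1..n. (\<theta> (r' i) - \<theta> (r i))\<^sup>2)"
    and rhat_meas: "rhat \<in> measurable (obs_space n) (count_space (rank_space n c))"
    and rhat_argmin: "\<And>x. x \<in> space (obs_space n) \<Longrightarrow>
        is_arg_min (\<lambda>r. \<Sum>i=1..n. (score n x i - \<theta> (r i))\<^sup>2) (\<lambda>r. r \<in> rank_space n c) (rhat x)"
begin

text \<open>
  The observations, the estimate, the scores of the pure noise, and the squared Euclidean
  distance to the true rank vector.  The first three are functions on the noise space
  \<open>M\<close>, where all probabilities below are computed.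
\<close>

definition obs :: "'w \<Rightarrow> nat \<times> nat \<Rightarrow> real" where
  "obs \<omega> = (\<lambda>(i, j)\<in>off_diag n. \<theta> (r i) + \<theta> (r j) + Z i j \<omega>)"

definition est :: "'w \<Rightarrow> nat \<Rightarrow> nat" where
  "est \<omega> = rhat (obs \<omega>)"

definition noise_score :: "nat \<Rightarrow> 'w \<Rightarrow> real" where
  "noise_score i \<omega> = score n (\<lambda>(k, l). Z k l \<omega>) i"

definition sqdist :: "(nat \<Rightarrow> nat) \<Rightarrow> real" where
  "sqdist r' = (\<Sum>i=1..n. (real (r' i) - real (r i))\<^sup>2)"

lemma obs_measurable [measurable]: "obs \<in> measurable M (obs_space n)"
  unfolding obs_def obs_space_def
proof (rule measurable_restrict)
  fix p assume "p \<in> off_diag n"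
  then show "(\<lambda>\<omega>. case p of (i, j) \<Rightarrow> \<theta> (r i) + \<theta> (r j) + Z i j \<omega>) \<in> borel_measurable M"
    using Z_meas by (cases p) auto
qed

lemma law_eq: "additive_law n \<theta> M Z r = distr M (obs_space n) obs"
  by (simp add: additive_law_def obs_def[abs_def])

lemma est_measurable: "est \<in> measurable M (count_space (rank_space n c))"
  unfolding est_def[abs_def] by (rule measurable_compose[OF obs_measurable rhat_meas])

lemma est_in: "\<omega> \<in> space M \<Longrightarrow> est \<omega> \<in> rank_space n c"
  using measurable_space[OF est_measurable] by simp

lemma finite_rank_space: "finite (rank_space n c)"
  by (rule finite_subset[of _ "{1..n} \<rightarrow>\<^sub>E {1..n}"]) (auto simp: rank_space_def intro!: finite_PiE)

lemma est_borel: "(\<lambda>\<omega>. f (est \<omega>) :: real) \<in> borel_measurable M"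
  by (rule measurable_compose[OF est_measurable]) simp

lemma est_event [measurable]: "{\<omega> \<in> space M. est \<omega> = r'} \<in> sets M"
proof -
  have "(\<lambda>\<omega>. of_bool (est \<omega> = r') :: real) -` {1} \<inter> space M \<in> sets M"
    by (rule measurable_sets[OF est_borel]) simp
  also have "(\<lambda>\<omega>. of_bool (est \<omega> = r') :: real) -` {1} \<inter> space M = {\<omega> \<in> space M. est \<omega> = r'}"
    by auto
  finally show ?thesis .
qed

lemma est_integrable: "integrable M (\<lambda>\<omega>. f (est \<omega>) :: real)"
proof (rule integrable_const_bound)
  show "AE \<omega> in M. norm (f (est \<omega>)) \<le> (\<Sum>r'\<in>rank_space n c. \<bar>f r'\<bar>)"
    using est_in finite_rank_space by (intro AE_I2) (auto intro: member_le_sum)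
qed (rule est_borel)

lemma expectation_est:
  "expectation (\<lambda>\<omega>. f (est \<omega>) :: real) =
     (\<Sum>r'\<in>rank_space n c. f r' * prob {\<omega> \<in> space M. est \<omega> = r'})"
proof -
  have "expectation (\<lambda>\<omega>. f (est \<omega>)) =
      expectation (\<lambda>\<omega>. \<Sum>r'\<in>rank_space n c. f r' * indicator {\<omega> \<in> space M. est \<omega> = r'} \<omega>)"
  proof (rule Bochner_Integration.integral_cong[OF refl])
    fix \<omega> assume \<omega>: "\<omega> \<in> space M"
    have "(\<Sum>r'\<in>rank_space n c. f r' * indicator {\<omega> \<in> space M. est \<omega> = r'} \<omega>) =
        (\<Sum>r'\<in>rank_space n c. if est \<omega> = r' then f r' else 0)"
      using \<omega> by (intro sum.cong) (auto simp: indicator_def)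
    then show "f (est \<omega>) = (\<Sum>r'\<in>rank_space n c. f r' * indicator {\<omega> \<in> space M. est \<omega> = r'} \<omega>)"
      using est_in[OF \<omega>] finite_rank_space by simp
  qed
  also have "\<dots> = (\<Sum>r'\<in>rank_space n c. f r' * prob {\<omega> \<in> space M. est \<omega> = r'})"
    by (simp add: emeasure_eq_measure)
  finally show ?thesis .
qed

lemma risk_eq:
  "(\<integral>x. f (rhat x) \<partial>additive_law n \<theta> M Z r) = (expectation (\<lambda>\<omega>. f (est \<omega>)) :: real)"
proof -
  have "(\<lambda>x. f (rhat x)) \<in> borel_measurable (obs_space n)"
    by (rule measurable_compose[OF rhat_meas]) simp
  then show ?thesis
    unfolding law_eq est_def by (rule integral_distr[OF obs_measurable])
qed

lemma prob_correct_eq: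
  "measure (additive_law n \<theta> M Z r) {x \<in> space (obs_space n). rhat x = r} =
     prob {\<omega> \<in> space M. est \<omega> = r}"
proof -
  have "{x \<in> space (obs_space n). rhat x = r} = rhat -` {r} \<inter> space (obs_space n)"
    by auto
  also have "\<dots> \<in> sets (obs_space n)"
    using r_in by (intro measurable_sets[OF rhat_meas]) auto
  finally have "measure (additive_law n \<theta> M Z r) {x \<in> space (obs_space n). rhat x = r} =
      prob (obs -` {x \<in> space (obs_space n). rhat x = r} \<inter> space M)"
    unfolding law_eq by (intro measure_distr obs_measurable)
  also have "obs -` {x \<in> space (obs_space n). rhat x = r} \<inter> space M = {\<omega> \<in> space M. est \<omega> = r}"
    using measurable_space[OF obs_measurable] by (auto simp: est_def)
  finally show ?thesis .
qed

section \<open>Tails of the scores and the basic inequality\<close>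

lemma noise_sum_measurable: "(\<lambda>\<omega>. \<Sum>(i, j)\<in>off_diag n. v i j * Z i j \<omega>) \<in> borel_measurable M"
  using Z_meas by (intro borel_measurable_sum) auto

text \<open>
  The sub-Gaussian hypothesis for weights that need not be normalised, and for the
  non-strict event.  The latter is reached from the strict events at levels \<open>u < t\<close> by
  letting \<open>u\<close> tend to \<open>t\<close>.
\<close>

lemma noise_tail:
  assumes t: "t > 0" and V: "V > 0" and v: "(\<Sum>(i, j)\<in>off_diag n. (v i j)\<^sup>2) \<le> V"
  shows "prob {\<omega> \<in> space M. t \<le> (\<Sum>(i, j)\<in>off_diag n. v i j * Z i j \<omega>)} \<le>
           exp (- t\<^sup>2 / (2 * \<sigma>\<^sup>2 * V))"
proof -
  define U where "U = (\<Sum>(i, j)\<in>off_diag n. (v i j)\<^sup>2)"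
  define Y where "Y \<omega> = (\<Sum>(i, j)\<in>off_diag n. v i j * Z i j \<omega>)" for \<omega>
  have [measurable]: "Y \<in> borel_measurable M"
    unfolding Y_def[abs_def] by (rule noise_sum_measurable)
  have "U \<ge> 0" unfolding U_def by (intro sum_nonneg) auto
  then consider "U = 0" | "U > 0" by linarith
  then have "prob {\<omega> \<in> space M. t \<le> Y \<omega>} \<le> exp (- t\<^sup>2 / (2 * \<sigma>\<^sup>2 * V))"
  proof cases
    case 1
    then have "v i j = 0" if "(i, j) \<in> off_diag n" for i j
      using that unfolding U_def by (subst (asm) sum_nonneg_eq_0_iff) auto
    then have "Y \<omega> = 0" for \<omega>
      unfolding Y_def by (intro sum.neutral) auto
    then have "prob {\<omega> \<in> space M. t \<le> Y \<omega>} = 0" using t by simp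
    then show ?thesis by simp
  next
    case 2
    have strict: "prob {\<omega> \<in> space M. t \<le> Y \<omega>} \<le> exp (- u\<^sup>2 / (2 * \<sigma>\<^sup>2 * V))"
      if u: "0 < u" "u < t" for u
    proof -
      have scaled: "(\<Sum>(i, j)\<in>off_diag n. (v i j / sqrt U) * Z i j \<omega>) = Y \<omega> / sqrt U" for \<omega>
        by (simp add: Y_def sum_divide_distrib split_beta)
      have "(\<Sum>(i, j)\<in>off_diag n. (v i j / sqrt U)\<^sup>2) = U / U"
        using 2 by (simp add: U_def power_divide split_beta flip: sum_divide_distrib)
      then have "(\<Sum>(i, j)\<in>off_diag n. (v i j / sqrt U)\<^sup>2) = 1" using 2 by simp
      then have "prob {\<omega> \<in> space M. (\<Sum>(i, j)\<in>off_diag n. (v i j / sqrt U) * Z i j \<omega>) > u / sqrt U}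
          \<le> exp (- (u / sqrt U)\<^sup>2 / (2 * \<sigma>\<^sup>2))"
        using noise u 2
        by (intro noise[unfolded subgaussian_noise_def, rule_format]) auto
      then have "prob {\<omega> \<in> space M. Y \<omega> > u} \<le> exp (- (u\<^sup>2 / U) / (2 * \<sigma>\<^sup>2))"
        using 2 unfolding scaled by (simp add: divide_less_cancel power_divide)
      moreover have "prob {\<omega> \<in> space M. t \<le> Y \<omega>} \<le> prob {\<omega> \<in> space M. Y \<omega> > u}"
        using u by (intro finite_measure_mono) auto
      moreover have "u\<^sup>2 / (2 * \<sigma>\<^sup>2 * V) \<le> u\<^sup>2 / (2 * \<sigma>\<^sup>2 * U)"
        using 2 V v sigma_pos unfolding U_def[symmetric] by (intro divide_left_mono) auto
      then have "exp (- (u\<^sup>2 / U) / (2 * \<sigma>\<^sup>2)) \<le> exp (- u\<^sup>2 / (2 * \<sigma>\<^sup>2 * V))"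
        by (simp add: mult.commute)
      ultimately show ?thesis by linarith
    qed
    show ?thesis
    proof (rule tendsto_lowerbound)
      show "((\<lambda>u. exp (- u\<^sup>2 / (2 * \<sigma>\<^sup>2 * V))) \<longlongrightarrow> exp (- t\<^sup>2 / (2 * \<sigma>\<^sup>2 * V))) (at_left t)"
        using V sigma_pos by (intro tendsto_intros) auto
      show "\<forall>\<^sub>F u in at_left t. prob {\<omega> \<in> space M. t \<le> Y \<omega>} \<le> exp (- u\<^sup>2 / (2 * \<sigma>\<^sup>2 * V))"
        using t strict by (auto simp: eventually_at_left[OF t])
    qed simp
  qed
  then show ?thesis by (simp add: Y_def)
qed

lemma score_obs: "i \<in> {1..n} \<Longrightarrow> score n (obs \<omega>) i = \<theta> (r i) + noise_score i \<omega>"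
proof -
  assume i: "i \<in> {1..n}"
  have "score n (obs \<omega>) i =
      score n (\<lambda>p. (\<lambda>(k, l). \<theta> (r k) + \<theta> (r l)) p + (\<lambda>(k, l). Z k l \<omega>) p) i"
    using i by (intro score_cong) (auto simp: obs_def)
  then show ?thesis
    using n i score_additive[of n i "\<lambda>k. \<theta> (r k)"] by (simp only: score_add noise_score_def)
qed

lemma linear_score_measurable: "(\<lambda>\<omega>. \<Sum>i=1..n. \<Delta> i * noise_score i \<omega>) \<in> borel_measurable M"
  unfolding noise_score_def sum_mult_score by (rule noise_sum_measurable)

lemma linear_score_tail:
  assumes t: "t > 0" and V: "V > 0" and \<Delta>: "(\<Sum>i=1..n. (\<Delta> i)\<^sup>2) \<le> V"
  shows "prob {\<omega> \<in> space M. t \<le> (\<Sum>i=1..n. \<Delta> i * noise_score i \<omega>)} \<le>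
           exp (- (real n - 2) * t\<^sup>2 / (\<sigma>\<^sup>2 * V))"
proof -
  have "(\<Sum>(k, l)\<in>off_diag n. (score_weight n \<Delta> k l)\<^sup>2) \<le> V / (2 * (real n - 2))"
    using n by (intro order.trans[OF sum_score_weight_le] divide_right_mono \<Delta>) auto
  then have "prob {\<omega> \<in> space M. t \<le> (\<Sum>i=1..n. \<Delta> i * noise_score i \<omega>)} \<le>
      exp (- t\<^sup>2 / (2 * \<sigma>\<^sup>2 * (V / (2 * (real n - 2)))))"
    unfolding noise_score_def sum_mult_score using n t V by (intro noise_tail) auto
  also have "- t\<^sup>2 / (2 * \<sigma>\<^sup>2 * (V / (2 * (real n - 2)))) = - (real n - 2) * t\<^sup>2 / (\<sigma>\<^sup>2 * V)"
    using n V sigma_pos by (simp add: field_simps)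
  finally show ?thesis .
qed

text \<open>
  With \<open>\<Delta>\<^sub>i\<close> the parameter error of the estimate, minimality against the true vector reads
  \<open>\<Sum>\<^sub>i (W\<^sub>i - \<Delta>\<^sub>i)\<^sup>2 \<le> \<Sum>\<^sub>i W\<^sub>i\<^sup>2\<close>.
\<close>

lemma basic_inequality:
  assumes \<omega>: "\<omega> \<in> space M"
  shows "(\<Sum>i=1..n. (\<theta> (est \<omega> i) - \<theta> (r i))\<^sup>2) \<le>
           2 * (\<Sum>i=1..n. (\<theta> (est \<omega> i) - \<theta> (r i)) * noise_score i \<omega>)"
proof -
  have "obs \<omega> \<in> space (obs_space n)" using measurable_space[OF obs_measurable \<omega>] .
  from rhat_argmin[OF this] r_in
  have "(\<Sum>i=1..n. (score n (obs \<omega>) i - \<theta> (est \<omega> i))\<^sup>2) \<le> (\<Sum>i=1..n. (score n (obs \<omega>) i - \<theta> (r i))\<^sup>2)"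
    unfolding is_arg_min_def est_def by (auto simp: not_less)
  then have "0 \<le> (\<Sum>i=1..n. (score n (obs \<omega>) i - \<theta> (r i))\<^sup>2 - (score n (obs \<omega>) i - \<theta> (est \<omega> i))\<^sup>2)"
    by (simp add: sum_subtractf)
  also have "\<dots> = (\<Sum>i=1..n. 2 * ((\<theta> (est \<omega> i) - \<theta> (r i)) * noise_score i \<omega>) - (\<theta> (est \<omega> i) - \<theta> (r i))\<^sup>2)"
    by (intro sum.cong) (auto simp: score_obs power2_eq_square algebra_simps)
  finally show ?thesis
    by (simp add: sum_subtractf sum_distrib_left)
qed

end

section \<open>Comparison of the losses with the squared distance\<close>

text \<open>
  A coordinatewise bound \<open>f\<close> on the loss, for the two forms of the loss at once.
\<close>

lemma rank_loss_le_average: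
  assumes "\<And>i. i \<in> {1..n} \<Longrightarrow> q = 0 \<Longrightarrow> of_bool (r' i \<noteq> r i) \<le> f i"
    and "\<And>i. i \<in> {1..n} \<Longrightarrow> q \<noteq> 0 \<Longrightarrow> \<bar>real (r' i) - real (r i)\<bar> powr q \<le> f i"
  shows "rank_loss q n r' r \<le> (\<Sum>i=1..n. f i) / real n"
proof (cases "q = 0")
  case True
  then have "(\<Sum>i=1..n. of_bool (r' i \<noteq> r i)) \<le> (\<Sum>i=1..n. f i)"
    using assms(1) by (intro sum_mono)
  from divide_right_mono[OF this, of "real n"] True show ?thesis
    unfolding rank_loss_def by (simp only: if_True mult_1 times_divide_eq_left) simp
next
  case False
  then have "(\<Sum>i=1..n. \<bar>real (r' i) - real (r i)\<bar> powr q) \<le> (\<Sum>i=1..n. f i)"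
    using assms(2) by (intro sum_mono)
  from divide_right_mono[OF this, of "real n"] False show ?thesis
    by (simp add: rank_loss_def)
qed

lemma rank_loss_le_sqdist:
  assumes q: "q \<in> {0..2}"
  shows "rank_loss q n r' r \<le> (\<Sum>i=1..n. (real (r' i) - real (r i))\<^sup>2) / real n"
proof -
  have int_diff: "1 \<le> \<bar>real (r' i) - real (r i)\<bar>" if "r' i \<noteq> r i" for i
    using that by linarith
  have bool_le: "of_bool (r' i \<noteq> r i) \<le> (real (r' i) - real (r i))\<^sup>2" for i
    using int_diff[of i] by (auto simp: abs_le_square_iff[of 1, simplified])
  have powr_le: "\<bar>real (r' i) - real (r i)\<bar> powr q \<le> (real (r' i) - real (r i))\<^sup>2" for i
  proof (cases "r' i = r i")
    case False
    then have "\<bar>real (r' i) - real (r i)\<bar> powr q \<le> \<bar>real (r' i) - real (r i)\<bar> powr 2"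
      using q int_diff[of i] by (intro powr_mono) auto
    then show ?thesis using False by simp
  qed simp
  show ?thesis
    by (intro rank_loss_le_average bool_le powr_le)
qed

lemma rank_loss_le_scaled:
  assumes q: "q \<in> {0..2}" and n: "n \<ge> 1" and s: "s > 0"
  shows "rank_loss q n r' r \<le>
    s powr (- q / 2) * (1 + s * ((\<Sum>i=1..n. (real (r' i) - real (r i))\<^sup>2) / real n))"
proof -
  have powr_le: "\<bar>x\<bar> powr q \<le> s powr (- q / 2) * (1 + s * x\<^sup>2)" for x :: real
  proof (cases "x = 0")
    case False
    define y where "y = s * x\<^sup>2"
    have y: "y > 0" using s False by (simp add: y_def)
    \<comment> \<open>The exponent \<open>q / 2\<close> lies between 0 and 1.\<close>
    have "y powr (q / 2) \<le> 1 + y"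
    proof (cases "y \<le> 1")
      case True
      then show ?thesis using y q powr_mono2[of "q / 2" y 1] by simp
    next
      case False
      then show ?thesis using q powr_mono[of "q / 2" 1 y] by simp
    qed
    moreover have "y powr (q / 2) = s powr (q / 2) * \<bar>x\<bar> powr q"
    proof -
      have "x\<^sup>2 = \<bar>x\<bar> powr 2" using False by simp
      then have "x\<^sup>2 powr (q / 2) = \<bar>x\<bar> powr q" by (simp only: powr_powr) simp
      then show ?thesis using s by (simp add: y_def powr_mult)
    qed
    ultimately have "s powr (- q / 2) * (s powr (q / 2) * \<bar>x\<bar> powr q) \<le> s powr (- q / 2) * (1 + y)"
      by (intro mult_left_mono) auto
    moreover have "s powr (- q / 2) * s powr (q / 2) = 1"
      using s by (simp flip: powr_add)
    ultimately show ?thesis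
      unfolding y_def[symmetric] by (simp only: mult.assoc[symmetric] mult_1)
  qed (use s in simp)
  have "rank_loss q n r' r \<le>
      (\<Sum>i=1..n. s powr (- q / 2) * (1 + s * (real (r' i) - real (r i))\<^sup>2)) / real n"
  proof (intro rank_loss_le_average powr_le)
    fix i assume "q = 0"
    then show "of_bool (r' i \<noteq> r i) \<le> s powr (- q / 2) * (1 + s * (real (r' i) - real (r i))\<^sup>2)"
      using s by (simp add: add_increasing2)
  qed
  also have "\<dots> = s powr (- q / 2) * (1 + s * ((\<Sum>i=1..n. (real (r' i) - real (r i))\<^sup>2) / real n))"
    using n by (simp add: sum.distrib divide_simps flip: sum_distrib_left)
  finally show ?thesis .
qed

lemma rank_loss_le_trivial:
  assumes q: "q \<in> {0..2}" and n: "n \<ge> 1"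
    and r: "r \<in> rank_space n c" and r': "r' \<in> rank_space n c"
  shows "rank_loss q n r' r \<le> real n powr q"
proof -
  have "real (r' i) \<le> real n" "real (r i) \<le> real n" if "i \<in> {1..n}" for i
    using r r' that by (auto simp: rank_space_def PiE_iff)
  then have "\<bar>real (r' i) - real (r i)\<bar> \<le> real n" if "i \<in> {1..n}" for i
    using that by (smt (verit) of_nat_0_le_iff)
  then have "rank_loss q n r' r \<le> (\<Sum>i=1..n. real n powr q) / real n"
    using q n by (intro rank_loss_le_average powr_mono2) auto
  then show ?thesis using n by simp
qed

section \<open>Expected squared distance of the estimator\<close>

text \<open>
  The constant that results from the exponential moment of order \<open>\<mu> = 1/6\<close>.
\<close>

definition high_snr_const :: real where
  "high_snr_const = 12 * exp (1 / 6) / (1 - exp (- 1 / 6))"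

context additive_ranking
begin

lemma sqdist_nonneg: "sqdist r' \<ge> 0"
  by (simp add: sqdist_def sum_nonneg)

text \<open>
  A single competitor is selected only if the linear form of its parameter differences
  exceeds half of their sum of squares \<open>G\<close>.
\<close>

lemma prob_est_le:
  assumes r': "r' \<in> rank_space n c"
  shows "prob {\<omega> \<in> space M. est \<omega> = r'} \<le> exp (- ((1 - 2 / n) * snr n \<beta> \<sigma> * sqdist r'))"
proof -
  define G where "G = (\<Sum>i=1..n. (\<theta> (r' i) - \<theta> (r i))\<^sup>2)"
  have G: "\<beta>\<^sup>2 * sqdist r' \<le> G" using separation[OF r'] by (simp add: G_def sqdist_def)
  have exponent: "(1 - 2 / n) * snr n \<beta> \<sigma> * sqdist r' = (real n - 2) / (4 * \<sigma>\<^sup>2) * (\<beta>\<^sup>2 * sqdist r')"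
  proof -
    have "1 - 2 / real n = (real n - 2) / real n" using n by (simp add: diff_divide_distrib)
    then show ?thesis using n by (simp add: snr_def)
  qed
  have le: "(1 - 2 / n) * snr n \<beta> \<sigma> * sqdist r' \<le> (real n - 2) / (4 * \<sigma>\<^sup>2) * G"
    unfolding exponent using n G by (intro mult_left_mono) auto
  have "prob {\<omega> \<in> space M. est \<omega> = r'} \<le> exp (- ((real n - 2) / (4 * \<sigma>\<^sup>2) * G))"
  proof (cases "G > 0")
    case True
    have "prob {\<omega> \<in> space M. est \<omega> = r'} \<le>
        prob {\<omega> \<in> space M. G / 2 \<le> (\<Sum>i=1..n. (\<theta> (r' i) - \<theta> (r i)) * noise_score i \<omega>)}"
    proof (rule finite_measure_mono)
      show "{\<omega> \<in> space M. est \<omega> = r'} \<subseteq>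
          {\<omega> \<in> space M. G / 2 \<le> (\<Sum>i=1..n. (\<theta> (r' i) - \<theta> (r i)) * noise_score i \<omega>)}"
      proof safe
        fix \<omega> assume "\<omega> \<in> space M" "r' = est \<omega>"
        then show "G / 2 \<le> (\<Sum>i=1..n. (\<theta> (est \<omega> i) - \<theta> (r i)) * noise_score i \<omega>)"
          using basic_inequality[of \<omega>] by (simp add: G_def)
      qed
    qed (use linear_score_measurable in measurable)
    also have "\<dots> \<le> exp (- (real n - 2) * (G / 2)\<^sup>2 / (\<sigma>\<^sup>2 * G))"
      using True by (intro linear_score_tail) (auto simp: G_def)
    also have "- (real n - 2) * (G / 2)\<^sup>2 / (\<sigma>\<^sup>2 * G) = - ((real n - 2) / (4 * \<sigma>\<^sup>2) * G)"
      using True by (simp add: power2_eq_square divide_simps) (simp add: algebra_simps)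
    finally show ?thesis .
  next
    case False
    moreover have "G \<ge> 0" by (simp add: G_def sum_nonneg)
    ultimately show ?thesis by simp
  qed
  also have "\<dots> \<le> exp (- ((1 - 2 / n) * snr n \<beta> \<sigma> * sqdist r'))"
    using le by simp
  finally show ?thesis .
qed

text \<open>
  The constraint on the sum of the ranks is dropped in the union bound, which makes the sum
  over competitors a product over coordinates.
\<close>

lemma exp_moment_sqdist_le:
  fixes \<mu> :: real
  defines "\<kappa> \<equiv> (1 - 2 / n) * snr n \<beta> \<sigma> - \<mu>"
  assumes \<kappa>: "\<kappa> > 0"
  shows "expectation (\<lambda>\<omega>. exp (\<mu> * sqdist (est \<omega>))) \<le> exp (2 * n * (exp (- \<kappa>) / (1 - exp (- \<kappa>))))"
proof -
  have "expectation (\<lambda>\<omega>. exp (\<mu> * sqdist (est \<omega>))) =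
      (\<Sum>r'\<in>rank_space n c. exp (\<mu> * sqdist r') * prob {\<omega> \<in> space M. est \<omega> = r'})"
    by (rule expectation_est)
  also have "\<dots> \<le> (\<Sum>r'\<in>rank_space n c. exp (- \<kappa> * sqdist r'))"
  proof (rule sum_mono)
    fix r' assume "r' \<in> rank_space n c"
    then have "exp (\<mu> * sqdist r') * prob {\<omega> \<in> space M. est \<omega> = r'} \<le>
        exp (\<mu> * sqdist r') * exp (- ((1 - 2 / n) * snr n \<beta> \<sigma> * sqdist r'))"
      by (intro mult_left_mono prob_est_le) auto
    also have "\<dots> = exp (- \<kappa> * sqdist r')"
      unfolding \<kappa>_def exp_add[symmetric] by (simp add: algebra_simps)
    finally show "exp (\<mu> * sqdist r') * prob {\<omega> \<in> space M. est \<omega> = r'} \<le> exp (- \<kappa> * sqdist r')" .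
  qed
  also have "\<dots> \<le> (\<Sum>r'\<in>{1..n} \<rightarrow>\<^sub>E {1..n}. exp (- \<kappa> * sqdist r'))"
    by (intro sum_mono2 finite_PiE) (auto simp: rank_space_def)
  also have "\<dots> = (\<Sum>r'\<in>{1..n} \<rightarrow>\<^sub>E {1..n}. \<Prod>i=1..n. exp (- \<kappa> * (real (r' i) - real (r i))\<^sup>2))"
    by (simp add: sqdist_def sum_distrib_left exp_sum flip: sum_negf)
  also have "\<dots> = (\<Prod>i=1..n. \<Sum>a=1..n. exp (- \<kappa> * (real a - real (r i))\<^sup>2))"
    by (subst prod_sum_PiE) auto
  also have "\<dots> \<le> (\<Prod>i=1..n. exp (2 * (exp (- \<kappa>) / (1 - exp (- \<kappa>)))))"
  proof (intro prod_mono conjI)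
    fix i
    show "(\<Sum>a=1..n. exp (- \<kappa> * (real a - real (r i))\<^sup>2)) \<le> exp (2 * (exp (- \<kappa>) / (1 - exp (- \<kappa>))))"
      by (rule order.trans[OF sum_exp_neg_square_le[OF \<kappa>] exp_ge_add_one_self])
  qed (intro sum_nonneg, simp)
  also have "\<dots> = exp (2 * n * (exp (- \<kappa>) / (1 - exp (- \<kappa>))))"
    by (simp add: exp_of_nat_mult[symmetric] algebra_simps)
  finally show ?thesis .
qed

text \<open>
  If \<open>E exp (\<mu> d\<^sup>2) \<le> exp a\<close> then \<open>1 + \<mu> E d\<^sup>2 - a \<le> E exp (\<mu> d\<^sup>2 - a) \<le> 1\<close>.  This
  keeps the linear dependence on \<open>n exp (- \<kappa>)\<close> whether that number is large or small.
\<close>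

lemma expected_sqdist_le:
  fixes \<mu> :: real
  defines "\<kappa> \<equiv> (1 - 2 / n) * snr n \<beta> \<sigma> - \<mu>"
  assumes \<mu>: "\<mu> > 0" and \<kappa>: "\<kappa> > 0"
  shows "expectation (\<lambda>\<omega>. sqdist (est \<omega>)) \<le> 2 * n * (exp (- \<kappa>) / (1 - exp (- \<kappa>))) / \<mu>"
proof -
  define a where "a = 2 * n * (exp (- \<kappa>) / (1 - exp (- \<kappa>)))"
  have "1 + (\<mu> * expectation (\<lambda>\<omega>. sqdist (est \<omega>)) - a) =
      expectation (\<lambda>\<omega>. 1 + (\<mu> * sqdist (est \<omega>) - a))"
    using est_integrable[of sqdist] by (simp add: prob_space)
  also have "\<dots> \<le> expectation (\<lambda>\<omega>. exp (\<mu> * sqdist (est \<omega>) - a))"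
    by (intro integral_mono est_integrable exp_ge_add_one_self)
  also have "\<dots> = expectation (\<lambda>\<omega>. exp (\<mu> * sqdist (est \<omega>))) * exp (- a)"
    by (simp add: exp_diff exp_minus field_simps)
  also have "\<dots> \<le> exp a * exp (- a)"
    using exp_moment_sqdist_le[of \<mu>] \<kappa> unfolding \<kappa>_def a_def by (intro mult_right_mono) auto
  also have "\<dots> = 1" by (simp flip: exp_add)
  finally show ?thesis
    unfolding a_def[symmetric] using \<mu> by (simp add: field_simps)
qed

lemma expected_sqdist_high_snr:
  assumes s: "snr n \<beta> \<sigma> > 1"
  shows "expectation (\<lambda>\<omega>. sqdist (est \<omega>)) \<le>
           high_snr_const * (n * exp (- (1 - 2 / n) * snr n \<beta> \<sigma>))"
proof -
  define s' where "s' = (1 - 2 / n) * snr n \<beta> \<sigma>"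
  have "1 / 3 \<le> 1 - 2 / real n" using n by (simp add: field_simps)
  then have s': "s' \<ge> 1 / 3" unfolding s'_def using s mult_mono[of "1/3" "1 - 2 / real n" 1 "snr n \<beta> \<sigma>"] by simp
  have "expectation (\<lambda>\<omega>. sqdist (est \<omega>)) \<le>
      2 * n * (exp (- (s' - 1 / 6)) / (1 - exp (- (s' - 1 / 6)))) / (1 / 6)"
    unfolding s'_def by (rule expected_sqdist_le) (use s' in \<open>auto simp: s'_def\<close>)
  also have "\<dots> \<le> 2 * n * (exp (- (s' - 1 / 6)) / (1 - exp (- 1 / 6))) / (1 / 6)"
    using s' by (intro divide_right_mono mult_left_mono divide_left_mono mult_pos_pos) auto
  also have "\<dots> = high_snr_const * (n * exp (- s'))"
  proof -
    have "exp (- (s' - 1 / 6)) = exp (1 / 6) * exp (- s')" by (simp flip: exp_add)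
    then show ?thesis by (simp add: high_snr_const_def)
  qed
  finally show ?thesis by (simp only: s'_def mult_minus_left)
qed

lemma noise_score_moment:
  assumes i: "i \<in> {1..n}"
  shows "integrable M (\<lambda>\<omega>. (noise_score i \<omega>)\<^sup>2)"
    "expectation (\<lambda>\<omega>. (noise_score i \<omega>)\<^sup>2) \<le> \<sigma>\<^sup>2 / (2 * (real n - 2)) * gauss_moment"
proof -
  define a where "a = sqrt (\<sigma>\<^sup>2 / (2 * (real n - 2)))"
  have a2: "a\<^sup>2 = \<sigma>\<^sup>2 / (2 * (real n - 2))" using n by (simp add: a_def)
  have a: "a > 0" using n sigma_pos by (simp add: a_def)
  \<comment> \<open>The score of one individual is a linear form with a single nonzero weight.\<close>
  have pick: "(\<Sum>j=1..n. (if j = i then b else 0) * noise_score j \<omega>) = b * noise_score i \<omega>" for b \<omega>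
    using i by (simp add: if_distrib[of "\<lambda>x. x * _"] cong: if_cong)
  have [measurable]: "noise_score i \<in> borel_measurable M"
    using linear_score_measurable[of "\<lambda>j. if j = i then 1 else 0"] by (simp only: pick mult_1)
  have one: "prob {\<omega> \<in> space M. t \<le> b * noise_score i \<omega>} \<le> exp (- t\<^sup>2 / (2 * a\<^sup>2))"
    if t: "t > 0" and b: "b\<^sup>2 = 1" for t b
  proof -
    have "prob {\<omega> \<in> space M. t \<le> (\<Sum>j=1..n. (if j = i then b else 0) * noise_score j \<omega>)} \<le>
        exp (- (real n - 2) * t\<^sup>2 / (\<sigma>\<^sup>2 * 1))"
      using i t b by (intro linear_score_tail) (auto simp: if_distrib[of "\<lambda>x. x\<^sup>2"] cong: if_cong)
    also have "- (real n - 2) * t\<^sup>2 / (\<sigma>\<^sup>2 * 1) = - t\<^sup>2 / (2 * a\<^sup>2)"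
      using n sigma_pos by (simp add: a2 field_simps)
    finally show ?thesis unfolding pick .
  qed
  have two: "prob {\<omega> \<in> space M. t \<le> \<bar>noise_score i \<omega>\<bar>} \<le> 2 * exp (- t\<^sup>2 / (2 * a\<^sup>2))"
    if t: "t > 0" for t
  proof -
    have "prob {\<omega> \<in> space M. t \<le> \<bar>noise_score i \<omega>\<bar>} \<le>
        prob ({\<omega> \<in> space M. t \<le> 1 * noise_score i \<omega>} \<union> {\<omega> \<in> space M. t \<le> - 1 * noise_score i \<omega>})"
      by (intro finite_measure_mono) auto
    also have "\<dots> \<le> prob {\<omega> \<in> space M. t \<le> 1 * noise_score i \<omega>} +
        prob {\<omega> \<in> space M. t \<le> - 1 * noise_score i \<omega>}"
      by (intro measure_Un_le) auto
    finally show ?thesis using one[OF t, of 1] one[OF t, of "-1"] by simp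
  qed
  show "integrable M (\<lambda>\<omega>. (noise_score i \<omega>)\<^sup>2)"
    by (rule second_moment_le(1)[OF _ a two]) auto
  show "expectation (\<lambda>\<omega>. (noise_score i \<omega>)\<^sup>2) \<le> \<sigma>\<^sup>2 / (2 * (real n - 2)) * gauss_moment"
    using second_moment_le(2)[OF _ a two] by (simp add: a2)
qed

lemma snr_mult_expected_sqdist_le:
  "snr n \<beta> \<sigma> * (expectation (\<lambda>\<omega>. sqdist (est \<omega>)) / n) \<le> 3 / 2 * gauss_moment"
proof -
  have sq: "\<beta>\<^sup>2 * sqdist (est \<omega>) \<le> 4 * (\<Sum>i=1..n. (noise_score i \<omega>)\<^sup>2)" if \<omega>: "\<omega> \<in> space M" for \<omega>
  proof -
    define G where "G = (\<Sum>i=1..n. (\<theta> (est \<omega> i) - \<theta> (r i))\<^sup>2)"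
    \<comment> \<open>With these weights half of \<open>G\<close> is absorbed by the left-hand side.\<close>
    have "2 * (d * w) \<le> d\<^sup>2 / 2 + 2 * w\<^sup>2" for d w :: real
      using zero_le_power2[of "d - 2 * w"] by (simp add: power2_eq_square algebra_simps)
    then have "(\<Sum>i=1..n. 2 * ((\<theta> (est \<omega> i) - \<theta> (r i)) * noise_score i \<omega>)) \<le>
        (\<Sum>i=1..n. (\<theta> (est \<omega> i) - \<theta> (r i))\<^sup>2 / 2 + 2 * (noise_score i \<omega>)\<^sup>2)"
      by (intro sum_mono)
    also have "\<dots> = G / 2 + 2 * (\<Sum>i=1..n. (noise_score i \<omega>)\<^sup>2)"
      by (simp add: G_def sum.distrib sum_distrib_left sum_divide_distrib)
    finally have "G \<le> G / 2 + 2 * (\<Sum>i=1..n. (noise_score i \<omega>)\<^sup>2)"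
      using basic_inequality[OF \<omega>] by (simp add: G_def sum_distrib_left)
    moreover have "\<beta>\<^sup>2 * sqdist (est \<omega>) \<le> G"
      using separation[OF est_in[OF \<omega>]] by (simp add: G_def sqdist_def)
    ultimately show ?thesis by simp
  qed
  have "\<beta>\<^sup>2 * expectation (\<lambda>\<omega>. sqdist (est \<omega>)) = expectation (\<lambda>\<omega>. \<beta>\<^sup>2 * sqdist (est \<omega>))"
    by simp
  also have "\<dots> \<le> expectation (\<lambda>\<omega>. 4 * (\<Sum>i=1..n. (noise_score i \<omega>)\<^sup>2))"
    using noise_score_moment(1) sq by (intro integral_mono est_integrable) auto
  also have "\<dots> = 4 * (\<Sum>i=1..n. expectation (\<lambda>\<omega>. (noise_score i \<omega>)\<^sup>2))"
    using noise_score_moment(1) by simp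
  also have "\<dots> \<le> 4 * (\<Sum>i=1..n. \<sigma>\<^sup>2 / (2 * (real n - 2)) * gauss_moment)"
    using noise_score_moment(2) by (intro mult_left_mono sum_mono) auto
  finally have main: "\<beta>\<^sup>2 * expectation (\<lambda>\<omega>. sqdist (est \<omega>)) \<le> 4 * n * (\<sigma>\<^sup>2 / (2 * (real n - 2)) * gauss_moment)"
    by simp
  have "snr n \<beta> \<sigma> * (expectation (\<lambda>\<omega>. sqdist (est \<omega>)) / n) =
      \<beta>\<^sup>2 * expectation (\<lambda>\<omega>. sqdist (est \<omega>)) / (4 * \<sigma>\<^sup>2)"
    using n by (simp add: snr_def)
  also have "\<dots> \<le> 4 * n * (\<sigma>\<^sup>2 / (2 * (real n - 2)) * gauss_moment) / (4 * \<sigma>\<^sup>2)"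
    by (intro divide_right_mono main) auto
  also have "\<dots> = n / (2 * (real n - 2)) * gauss_moment"
    using sigma_pos by simp
  also have "\<dots> \<le> 3 / 2 * gauss_moment"
    using n gauss_moment_pos by (intro mult_right_mono) (auto simp: field_simps)
  finally show ?thesis .
qed

section \<open>Risk and exact recovery\<close>

lemma risk_le:
  assumes q: "q \<in> {0..2}"
  shows "(\<integral>x. rank_loss q n (rhat x) r \<partial>additive_law n \<theta> M Z r) \<le>
    (1 + high_snr_const + 3 / 2 * gauss_moment) * risk_rate q n (- 2 / n) (snr n \<beta> \<sigma>)"
proof -
  define s where "s = snr n \<beta> \<sigma>"
  define C where "C = 1 + high_snr_const + 3 / 2 * gauss_moment"
  have hc: "high_snr_const > 0" by (simp add: high_snr_const_def)
  note gm = gauss_moment_pos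
  have C: "C \<ge> 1" "C \<ge> high_snr_const" "C \<ge> 1 + 3 / 2 * gauss_moment"
    using hc gm by (auto simp: C_def)
  have s0: "s \<ge> 0" by (simp add: s_def snr_def)
  define L where "L = expectation (\<lambda>\<omega>. rank_loss q n (est \<omega>) r)"
  have trivial: "L \<le> n powr q"
  proof -
    have "L \<le> expectation (\<lambda>\<omega>. n powr q)"
      unfolding L_def using q n r_in est_in
      by (intro integral_mono est_integrable rank_loss_le_trivial[where c = c]) auto
    then show ?thesis by (simp add: prob_space)
  qed
  have trivialC: "n powr q \<le> C * n powr q" using C(1) mult_right_mono[of 1 C "n powr q"] by simp
  have "L \<le> C * risk_rate q n (- 2 / n) s"
  proof -
    consider "s > 1" | "s = 0" | "0 < s" "s \<le> 1" using s0 by linarith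
    then show ?thesis
    proof cases
      case 1
      have "L \<le> expectation (\<lambda>\<omega>. sqdist (est \<omega>) / n)"
        unfolding L_def sqdist_def using q by (intro integral_mono est_integrable rank_loss_le_sqdist)
      also have "\<dots> \<le> high_snr_const * (n * exp (- (1 - 2 / n) * s)) / n"
        unfolding integral_divide_zero s_def using 1
        by (intro divide_right_mono expected_sqdist_high_snr) (auto simp: s_def)
      also have "\<dots> = high_snr_const * exp (- (1 - 2 / n) * s)"
        using n by simp
      also have "\<dots> \<le> C * exp (- (1 - 2 / n) * s)"
        using C by (intro mult_right_mono) auto
      finally show ?thesis using 1 by (simp add: risk_rate_def)
    next
      case 2
      then show ?thesis using trivial trivialC by (simp add: risk_rate_def)
    next
      case 3
      have "L \<le> expectation (\<lambda>\<omega>. s powr (- q / 2) * (1 + s * (sqdist (est \<omega>) / n)))"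
        unfolding L_def sqdist_def using q n 3
        by (intro integral_mono est_integrable rank_loss_le_scaled) auto
      also have "\<dots> = s powr (- q / 2) * (1 + s * (expectation (\<lambda>\<omega>. sqdist (est \<omega>)) / n))"
        using est_integrable[of sqdist] by (simp add: prob_space)
      also have "\<dots> \<le> s powr (- q / 2) * C"
        using order.trans[OF add_left_mono[OF snr_mult_expected_sqdist_le, of 1] C(3)]
        unfolding s_def by (intro mult_left_mono) auto
      finally have "L \<le> C * s powr (- q / 2)" by (simp add: mult.commute)
      then show ?thesis using 3 trivial trivialC by (auto simp: risk_rate_def min_def)
    qed
  qed
  then show ?thesis
    unfolding risk_eq[of "\<lambda>r'. rank_loss q n r' r"] L_def C_def s_def .
qed

lemma prob_correct_ge:
  assumes s: "snr n \<beta> \<sigma> > 1"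
  shows "measure (additive_law n \<theta> M Z r) {x \<in> space (obs_space n). rhat x = r} \<ge>
    1 - high_snr_const * (n * exp (- (1 - 2 / n) * snr n \<beta> \<sigma>))"
proof -
  have "1 - expectation (\<lambda>\<omega>. sqdist (est \<omega>)) = expectation (\<lambda>\<omega>. 1 - sqdist (est \<omega>))"
    using est_integrable[of sqdist] by (simp add: prob_space)
  also have "\<dots> \<le> expectation (indicator {\<omega> \<in> space M. est \<omega> = r})"
  proof (rule integral_mono)
    fix \<omega> assume \<omega>: "\<omega> \<in> space M"
    show "1 - sqdist (est \<omega>) \<le> indicator {\<omega> \<in> space M. est \<omega> = r} \<omega>"
    proof (cases "est \<omega> = r")
      case True
      then show ?thesis using \<omega> sqdist_nonneg by simp
    next
      case False
      obtain i where i: "i \<in> {1..n}" "est \<omega> i \<noteq> r i"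
      proof -
        have "est \<omega> \<in> {1..n} \<rightarrow>\<^sub>E {1..n}" "r \<in> {1..n} \<rightarrow>\<^sub>E {1..n}"
          using est_in[OF \<omega>] r_in by (simp_all add: rank_space_def)
        then have "\<exists>i\<in>{1..n}. est \<omega> i \<noteq> r i"
          using False PiE_ext by metis
        then show ?thesis using that by blast
      qed
      have "1 \<le> \<bar>real (est \<omega> i) - real (r i)\<bar>" using i(2) by linarith
      then have "1 \<le> (real (est \<omega> i) - real (r i))\<^sup>2"
        using abs_le_square_iff[of 1 "real (est \<omega> i) - real (r i)"] by simp
      also have "\<dots> \<le> sqdist (est \<omega>)"
        unfolding sqdist_def by (rule member_le_sum[OF i(1)]) auto
      finally show ?thesis using False by simp
    qed
  qed (auto intro: est_integrable simp: emeasure_eq_measure)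
  also have "\<dots> = prob {\<omega> \<in> space M. est \<omega> = r}" by simp
  finally show ?thesis
    unfolding prob_correct_eq using expected_sqdist_high_snr[OF s] by linarith
qed

end

lemma rank_space_nonempty:
  assumes "c \<ge> 0"
  shows "rank_space n c \<noteq> {}"
proof -
  have "(\<lambda>i\<in>{1..n}. i) \<in> rank_space n c"
    using assms by (auto simp: rank_space_def)
  then show ?thesis by blast
qed

theorem theorem3p2:
  fixes q :: real
    and c \<sigma> \<beta> :: "nat \<Rightarrow> real"
    and \<theta> :: "nat \<Rightarrow> nat \<Rightarrow> real"
    and M :: "nat \<Rightarrow> 'w measure"
    and Z :: "nat \<Rightarrow> nat \<Rightarrow> nat \<Rightarrow> 'w \<Rightarrow> real"
    and rhat :: "nat \<Rightarrow> (nat \<times> nat \<Rightarrow> real) \<Rightarrow> nat \<Rightarrow> nat"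
  assumes q: "q \<in> {0..2}"
    and c_ge: "\<And>n. n \<ge> 3 \<Longrightarrow> c n \<ge> 1"
    and c_small: "c \<in> o(\<lambda>n. sqrt (real n))"
    and prob: "\<And>n. n \<ge> 3 \<Longrightarrow> prob_space (M n)"
    and Z_meas: "\<And>n i j. n \<ge> 3 \<Longrightarrow> (i, j) \<in> off_diag n \<Longrightarrow> Z n i j \<in> borel_measurable (M n)"
    and sigma_pos: "\<And>n. n \<ge> 3 \<Longrightarrow> \<sigma> n > 0"
    and noise: "\<And>n. n \<ge> 3 \<Longrightarrow> subgaussian_noise n (M n) (Z n) (\<sigma> n)"
    and separation: "\<And>n r r'. n \<ge> 3 \<Longrightarrow> r \<in> rank_space n (c n) \<Longrightarrow> r' \<in> rank_space n (c n) \<Longrightarrow>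
        (\<Sum>i = 1..n. (\<theta> n (r i) - \<theta> n (r' i))\<^sup>2)
          \<ge> (\<beta> n)\<^sup>2 * (L2_set (\<lambda>i. real (r' i) - real (r i)) {1..n})\<^sup>2"
    and rhat_meas: "\<And>n. n \<ge> 3 \<Longrightarrow>
        rhat n \<in> measurable (obs_space n) (count_space (rank_space n (c n)))"
    and rhat_argmin: "\<And>n x. n \<ge> 3 \<Longrightarrow> x \<in> space (obs_space n) \<Longrightarrow>
        is_arg_min (\<lambda>r. \<Sum>i = 1..n. (score n x i - \<theta> n (r i))\<^sup>2)
          (\<lambda>r. r \<in> rank_space n (c n)) (rhat n x)"
  shows "(\<exists>C > 0. \<exists>\<eta> :: nat \<Rightarrow> real. \<eta> \<longlonglongrightarrow> 0 \<and>
            (\<forall>n \<ge> 3.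
              (SUP r \<in> rank_space n (c n).
                 \<integral>x. rank_loss q n (rhat n x) r \<partial>(additive_law n (\<theta> n) (M n) (Z n) r))
                \<le> C * risk_rate q n (\<eta> n) (snr n (\<beta> n) (\<sigma> n))))
       \<and> (liminf (\<lambda>n. ereal (snr n (\<beta> n) (\<sigma> n) / ln (real n))) > 1 \<longrightarrow>
            (\<lambda>n. INF r \<in> rank_space n (c n).
                 measure (additive_law n (\<theta> n) (M n) (Z n) r)
                   {x \<in> space (obs_space n). rhat n x = r}) \<longlonglongrightarrow> 1)"
proof (intro conjI impI)
  have model: "additive_ranking (M n) n (\<theta> n) (Z n) (\<sigma> n) (\<beta> n) (c n) r (rhat n)"
    if "n \<ge> 3" "r \<in> rank_space n (c n)" for n r
  proof (intro additive_ranking.intro additive_ranking_axioms.intro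
      prob Z_meas sigma_pos noise rhat_meas rhat_argmin that)
    fix r' assume r': "r' \<in> rank_space n (c n)"
    have "(L2_set (\<lambda>i. real (r i) - real (r' i)) {1..n})\<^sup>2 = (\<Sum>i=1..n. (real (r' i) - real (r i))\<^sup>2)"
      by (simp add: L2_set_def sum_nonneg power2_commute)
    then show "(\<beta> n)\<^sup>2 * (\<Sum>i=1..n. (real (r' i) - real (r i))\<^sup>2) \<le> (\<Sum>i=1..n. (\<theta> n (r' i) - \<theta> n (r i))\<^sup>2)"
      using separation[OF that(1) r' that(2)] by simp
  qed
  have nonempty: "rank_space n (c n) \<noteq> {}" if "n \<ge> 3" for n
    using c_ge[OF that] by (intro rank_space_nonempty) simp

  show "\<exists>C > 0. \<exists>\<eta> :: nat \<Rightarrow> real. \<eta> \<longlonglongrightarrow> 0 \<and>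
      (\<forall>n \<ge> 3. (SUP r \<in> rank_space n (c n).
           \<integral>x. rank_loss q n (rhat n x) r \<partial>(additive_law n (\<theta> n) (M n) (Z n) r))
         \<le> C * risk_rate q n (\<eta> n) (snr n (\<beta> n) (\<sigma> n)))"
  proof (intro exI conjI allI impI)
    show "0 < 1 + high_snr_const + 3 / 2 * gauss_moment"
      using gauss_moment_pos by (simp add: high_snr_const_def add_pos_pos)
    show "(\<lambda>n. - 2 / real n) \<longlonglongrightarrow> 0"
      by (rule lim_const_over_n)
    fix n :: nat assume n: "3 \<le> n"
    show "(SUP r \<in> rank_space n (c n).
           \<integral>x. rank_loss q n (rhat n x) r \<partial>(additive_law n (\<theta> n) (M n) (Z n) r))
         \<le> (1 + high_snr_const + 3 / 2 * gauss_moment) *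
             risk_rate q n (- 2 / real n) (snr n (\<beta> n) (\<sigma> n))"
      by (intro cSUP_least nonempty n additive_ranking.risk_le[OF model[OF n]] q)
  qed

  assume "liminf (\<lambda>n. ereal (snr n (\<beta> n) (\<sigma> n) / ln (real n))) > 1"
  \<comment> \<open>A constant strictly between 1 and the limit inferior.\<close>
  then obtain b where b: "ereal b > 1" "ereal b < liminf (\<lambda>n. ereal (snr n (\<beta> n) (\<sigma> n) / ln (real n)))"
    using ereal_dense2 by blast
  then have b1: "b > 1" by simp
  have "\<forall>\<^sub>F n in sequentially. ereal b < ereal (snr n (\<beta> n) (\<sigma> n) / ln (real n))"
    by (rule less_LiminfD[OF b(2)])
  moreover have "\<forall>\<^sub>F n in sequentially. n \<ge> (3 :: nat)"
    by (rule eventually_ge_at_top)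
  ultimately have snr_large: "\<forall>\<^sub>F n in sequentially. n \<ge> 3 \<and> b * ln n < snr n (\<beta> n) (\<sigma> n)"
  proof eventually_elim
    case (elim n)
    have "ln (real n) > 0" using elim by simp
    then show ?case using elim by (simp add: pos_less_divide_eq)
  qed
  \<comment> \<open>An upper bound for the error probability, of order \<open>n\<close> to the power \<open>1 - b\<close>.\<close>
  define E where "E n = high_snr_const * (n * exp (- (1 - 2 / n) * (b * ln n)))" for n :: nat
  show "(\<lambda>n. INF r \<in> rank_space n (c n).
      measure (additive_law n (\<theta> n) (M n) (Z n) r)
        {x \<in> space (obs_space n). rhat n x = r}) \<longlonglongrightarrow> 1"
  proof (rule tendsto_sandwich)
    show "(\<lambda>n. 1 - E n) \<longlonglongrightarrow> 1"
    proof -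
      have "(\<lambda>n. real n * exp (- (1 - 2 / real n) * (b * ln (real n)))) \<longlonglongrightarrow> 0"
        using b1 by real_asymp
      then have "E \<longlonglongrightarrow> high_snr_const * 0"
        unfolding E_def by (intro tendsto_mult tendsto_const)
      from tendsto_diff[OF tendsto_const[of 1] this] show ?thesis by simp
    qed
    show "\<forall>\<^sub>F n in sequentially. 1 - E n \<le> (INF r \<in> rank_space n (c n).
      measure (additive_law n (\<theta> n) (M n) (Z n) r) {x \<in> space (obs_space n). rhat n x = r})"
      using snr_large
    proof eventually_elim
      case (elim n)
      then have n: "n \<ge> 3" and s: "b * ln n < snr n (\<beta> n) (\<sigma> n)" by auto
      have "exp 1 \<le> real n" using n e_less_272 by simp
      then have "1 \<le> ln (real n)" using n by (simp add: ln_ge_iff)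
      then have s1: "snr n (\<beta> n) (\<sigma> n) > 1" using b1 s mult_mono[of 1 b 1 "ln n"] by simp
      have "high_snr_const * (n * exp (- (1 - 2 / n) * snr n (\<beta> n) (\<sigma> n))) \<le> E n"
        unfolding E_def using n s
        by (intro mult_left_mono) (auto simp: high_snr_const_def intro!: mult_left_mono)
      then have "1 - E n \<le> measure (additive_law n (\<theta> n) (M n) (Z n) r)
          {x \<in> space (obs_space n). rhat n x = r}" if "r \<in> rank_space n (c n)" for r
        using additive_ranking.prob_correct_ge[OF model[OF n that] s1] by linarith
      then show ?case by (intro cINF_greatest nonempty n)
    qed
    show "\<forall>\<^sub>F n in sequentially. (INF r \<in> rank_space n (c n).
      measure (additive_law n (\<theta> n) (M n) (Z n) r) {x \<in> space (obs_space n). rhat n x = r}) \<le> 1"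
      using eventually_ge_at_top[of 3]
    proof eventually_elim
      case (elim n)
      then obtain r where r: "r \<in> rank_space n (c n)" using nonempty by blast
      interpret additive_ranking "M n" n "\<theta> n" "Z n" "\<sigma> n" "\<beta> n" "c n" r "rhat n"
        by (rule model[OF elim r])
      have "(INF r \<in> rank_space n (c n). measure (additive_law n (\<theta> n) (M n) (Z n) r)
          {x \<in> space (obs_space n). rhat n x = r}) \<le>
        measure (additive_law n (\<theta> n) (M n) (Z n) r) {x \<in> space (obs_space n). rhat n x = r}"
        by (intro cINF_lower bdd_belowI[of _ 0] r) auto
      also have "\<dots> \<le> 1" unfolding prob_correct_eq by simp
      finally show ?case .
    qed
  qed (rule tendsto_const)
qed

end
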